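(* Let $m \geq 2$ be an integer. Then the zeros of the polynomial $L_m^{(1)}(z)$ are contained in the interval $$\left[\,2-2\cos\left(\frac{\pi}{m+1}\right)\,;\ \left(2-2\cos\left(\frac{m\,\pi}{m+1}\right)\right) m\,\right].$$
   Context: $L_m^{(1)}$ denotes the $m$th $1$-associated Laguerre polynomial, $L_m^{(1)}(z)=\sum_{k=0}^{m}\binom{m+1}{m-k}\frac{(-z)^k}{k!}$. *)

theory Defs
  imports Complex_Main "HOL-Computational_Algebra.Polynomial"
begin

definition laguerre1 :: "nat \<Rightarrow> 'a::field_char_0 poly" where
  "laguerre1 m =
     (\<Sum>k\<le>m. monom (of_nat ((m + 1) choose (m - k)) * ((-1) ^ k / fact k)) k)"

lemma poly_laguerre1:
  "poly (laguerre1 m) z = (\<Sum>k\<le>m. of_nat ((m + 1) choose (m - k)) * ((- z) ^ k / fact k))"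
  by (simp add: laguerre1_def poly_sum poly_monom power_minus[of z] mult.assoc)

end

(* The three-term recurrence for the polynomials, divided by the index, says that at a zero z of
   the m-th one the vector w = (L_0(z), ..., L_(m-1)(z)) solves T w = z D w, where T is the
   tridiagonal Dirichlet matrix with rows (-1, 2, -1) and D = diag(1, 1/2, ..., 1/m). Hence z is
   the quotient of the two quadratic forms <T w, w> and <D w, w>: it is real, the spectrum of T
   lies between 2 - 2 cos(pi/(m+1)) and 2 + 2 cos(pi/(m+1)), and |w|^2 / m <= <D w, w> <= |w|^2. *)

theory Submission
  imports Defs
begin

text \<open>The vector \<open>s k\<close> = sin(k \<theta>) is a positive eigenvector of the path
  adjacency matrix for the eigenvalue 2 cos \<theta>, vanishing at 0 and m + 1. Completing squares
  relative to it leaves only nonnegative squares and a telescoping sum.\<close>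

lemma sum_square_bounds:
  fixes a :: "nat \<Rightarrow> real"
  assumes "a 0 = 0" "a (Suc m) = 0"
  shows "(\<Sum>k\<le>m. a k * a (Suc k)) \<le> cos (pi / (real m + 1)) * (\<Sum>k\<le>m. (a k)\<^sup>2)"
proof -
  define \<theta> where "\<theta> = pi / (real m + 1)"
  define s where "s k = sin (real k * \<theta>)" for k
  \<comment> \<open>The potential that telescopes; it vanishes at 0 and at \<open>Suc m\<close>
    because \<open>a\<close> does.\<close>
  define t where "t k = s (k - 1) / s k * (a k)\<^sup>2" for k
  have s_pos: "s k > 0" if "0 < k" "k \<le> m" for k
  proof -
    have "real k * pi < (real m + 1) * pi"
      using that by simp
    then have "real k * \<theta> < pi"
      by (simp add: \<theta>_def field_simps)
    then show ?thesis
      using that by (auto simp: s_def \<theta>_def intro!: sin_gt_zero)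
  qed
  have s_last: "s (Suc m) = 0"
    by (simp add: s_def \<theta>_def add.commute)
  have s_rec: "s (Suc (Suc k)) + s k = 2 * cos \<theta> * s (Suc k)" for k
  proof -
    have "s (Suc (Suc k)) = sin (real (Suc k) * \<theta> + \<theta>)" "s k = sin (real (Suc k) * \<theta> - \<theta>)"
      by (simp_all add: s_def algebra_simps)
    then show ?thesis
      unfolding s_def[of "Suc k"] sin_add sin_diff by simp
  qed
  have step: "2 * (a k * a (Suc k)) \<le> 2 * cos \<theta> * (a k)\<^sup>2 + (t (Suc k) - t k)" if "k \<le> m" for k
  proof (cases k)
    case 0
    then show ?thesis
      using assms(1) by (simp add: t_def s_def)
  next
    case (Suc j)
    have pos: "s k > 0"
      using s_pos Suc that by simp
    have "2 * cos \<theta> = (s (Suc k) + s j) / s k"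
      using s_rec[of j] pos Suc by (simp add: field_simps)
    then have eq: "2 * cos \<theta> * (a k)\<^sup>2 - t k = s (Suc k) / s k * (a k)\<^sup>2"
      using Suc by (simp add: t_def algebra_simps add_divide_distrib)
    show ?thesis
    proof (cases "k = m")
      case True
      then show ?thesis
        using eq assms(2) s_last by (simp add: t_def)
    next
      case False
      then have pos': "s (Suc k) > 0"
        using s_pos that by simp
      \<comment> \<open>The slack of the step is exactly this weighted square, which is zero when
        \<open>a\<close> is proportional to \<open>s\<close>.\<close>
      have "0 \<le> (s (Suc k) * a k - s k * a (Suc k))\<^sup>2 / (s k * s (Suc k))"
        using pos pos' by simp
      also have "\<dots> = s (Suc k) / s k * (a k)\<^sup>2 + t (Suc k) - 2 * (a k * a (Suc k))"
        using pos pos' by (simp add: t_def field_simps power2_eq_square)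
      finally show ?thesis
        using eq by simp
    qed
  qed
  have "(\<Sum>k\<le>m. 2 * (a k * a (Suc k))) \<le> (\<Sum>k\<le>m. 2 * cos \<theta> * (a k)\<^sup>2 + (t (Suc k) - t k))"
    using step by (intro sum_mono) simp
  also have "\<dots> = 2 * cos \<theta> * (\<Sum>k\<le>m. (a k)\<^sup>2) + (t (Suc m) - t 0)"
    by (simp add: sum.distrib sum_distrib_left sum_lessThan_telescope flip: lessThan_Suc_atMost
        del: sum.lessThan_Suc)
  also have "t (Suc m) - t 0 = 0"
    using assms by (simp add: t_def)
  finally show ?thesis
    by (simp add: \<theta>_def flip: sum_distrib_left)
qed

text \<open>The two triangle inequalities put each term of \<open>E\<close> between the squares of
  the difference and of the sum of the neighbouring norms. Only the norms enter, so complex vectors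
  are covered before \<open>z\<close> is known to be real.\<close>

lemma dirichlet_energy_bounds:
  fixes w :: "nat \<Rightarrow> 'a::real_normed_vector"
  assumes "w 0 = 0" "w (Suc m) = 0"
  defines "c \<equiv> 2 * cos (pi / (real m + 1))"
    and "S \<equiv> (\<Sum>k\<le>m. (norm (w k))\<^sup>2)"
    and "E \<equiv> (\<Sum>k\<le>m. (norm (w (Suc k) - w k))\<^sup>2)"
  shows "(2 - c) * S \<le> E" "E \<le> (2 + c) * S"
proof -
  define P where "P = (\<Sum>k\<le>m. norm (w k) * norm (w (Suc k)))"
  have P: "2 * P \<le> c * S"
    using sum_square_bounds[of "\<lambda>k. norm (w k)" m] assms by (simp add: P_def)
  have "(\<Sum>k\<le>m. (norm (w (Suc k)))\<^sup>2) = S"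
    using sum.atMost_Suc_shift[of "\<lambda>k. (norm (w k))\<^sup>2" m] assms by simp
  \<comment> \<open>The sign \<open>d\<close> is -1 for the lower bound and 1 for the upper
    one.\<close>
  then have split: "2 * S + d * (2 * P)
      = (\<Sum>k\<le>m. (norm (w (Suc k)))\<^sup>2 + (norm (w k))\<^sup>2 + d * (2 * (norm (w k) * norm (w (Suc k)))))" for d
    by (simp add: P_def S_def sum.distrib sum_distrib_left)
  have "2 * S + (-1) * (2 * P) \<le> E"
    unfolding split E_def
  proof (rule sum_mono)
    fix k
    have "\<bar>norm (w (Suc k)) - norm (w k)\<bar>\<^sup>2 \<le> (norm (w (Suc k) - w k))\<^sup>2"
      by (intro power_mono norm_triangle_ineq3) simp
    then show "(norm (w (Suc k)))\<^sup>2 + (norm (w k))\<^sup>2 + (-1) * (2 * (norm (w k) * norm (w (Suc k))))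
        \<le> (norm (w (Suc k) - w k))\<^sup>2"
      by (simp add: power2_eq_square algebra_simps)
  qed
  then show "(2 - c) * S \<le> E"
    using P by (simp add: algebra_simps)
  have "E \<le> 2 * S + 1 * (2 * P)"
    unfolding split E_def
  proof (rule sum_mono)
    fix k
    have "(norm (w (Suc k) - w k))\<^sup>2 \<le> (norm (w (Suc k)) + norm (w k))\<^sup>2"
      by (intro power_mono norm_triangle_ineq4) simp
    then show "(norm (w (Suc k) - w k))\<^sup>2
        \<le> (norm (w (Suc k)))\<^sup>2 + (norm (w k))\<^sup>2 + 1 * (2 * (norm (w k) * norm (w (Suc k))))"
      by (simp add: power2_eq_square algebra_simps)
  qed
  then show "E \<le> (2 + c) * S"
    using P by (simp add: algebra_simps)
qed

text \<open>The boundary terms are kept so that the induction goes through; they vanish for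
  Dirichlet data, leaving a real number.\<close>

lemma second_difference_summation_by_parts:
  fixes w :: "nat \<Rightarrow> complex"
  shows "(\<Sum>k<n. cnj (w (Suc k)) * (2 * w (Suc k) - w (Suc (Suc k)) - w k))
    = of_real (\<Sum>k\<le>n. (cmod (w (Suc k) - w k))\<^sup>2)
      - cnj (w (Suc n)) * (w (Suc n) - w n) + cnj (w 0) * (w 1 - w 0)"
  unfolding of_real_sum complex_norm_square by (induction n) (simp_all add: algebra_simps)

text \<open>Binomials beyond the degree are 0, so the range may be extended to any \<open>N\<close>;
  consecutive polynomials can then be compared term by term over one range.\<close>

lemma poly_laguerre1_eq:
  assumes "n \<le> N"
  shows "poly (laguerre1 n) z = (\<Sum>k\<le>N. of_nat (Suc n choose Suc k) * ((- z) ^ k / fact k))"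
proof -
  have "poly (laguerre1 n) z = (\<Sum>k\<le>n. of_nat (Suc n choose Suc k) * ((- z) ^ k / fact k))"
    unfolding poly_laguerre1
  proof (intro sum.cong refl)
    fix k assume "k \<in> {..n}"
    then show "of_nat ((n + 1) choose (n - k)) * ((- z) ^ k / fact k)
        = of_nat (Suc n choose Suc k) * ((- z) ^ k / fact k)"
      using binomial_symmetric[of "Suc k" "Suc n"] by simp
  qed
  also have "\<dots> = (\<Sum>k\<le>N. of_nat (Suc n choose Suc k) * ((- z) ^ k / fact k))"
    using assms by (intro sum.mono_neutral_left) (auto simp: binomial_eq_0)
  finally show ?thesis .
qed

text \<open>The shifted sequence starts with 0, so that the recurrence needs no separate initial case.\<close>

definition laguerre1_seq :: "'a::field_char_0 \<Rightarrow> nat \<Rightarrow> 'a" where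
  "laguerre1_seq z n = (case n of 0 \<Rightarrow> 0 | Suc k \<Rightarrow> poly (laguerre1 k) z)"

lemma laguerre1_seq_eq:
  assumes "n \<le> Suc N"
  shows "laguerre1_seq z n = (\<Sum>k\<le>N. of_nat (n choose Suc k) * ((- z) ^ k / fact k))"
  using assms by (cases n) (simp_all add: laguerre1_seq_def poly_laguerre1_eq del: binomial_Suc_Suc)

lemma laguerre1_seq_rec:
  "2 * laguerre1_seq z (Suc n) - laguerre1_seq z (Suc (Suc n)) - laguerre1_seq z n
    = z * laguerre1_seq z (Suc n) / of_nat (Suc n)"
proof -
  let ?e = "\<lambda>k. (- z) ^ k / fact k"
  have "2 * laguerre1_seq z (Suc n) - laguerre1_seq z (Suc (Suc n)) - laguerre1_seq z n
      = (\<Sum>k\<le>Suc n. (2 * of_nat (Suc n choose Suc k) - of_nat (Suc (Suc n) choose Suc k)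
          - of_nat (n choose Suc k)) * ?e k)"
    by (subst (1 2 3) laguerre1_seq_eq[of _ "Suc n"])
      (simp_all add: sum_distrib_left sum_subtractf left_diff_distrib diff_divide_distrib mult.assoc
        del: sum.atMost_Suc binomial_Suc_Suc)
  \<comment> \<open>Pascal's rule collapses the bracket; the term at index 0 cancels, which allows
    the shift.\<close>
  also have "\<dots> = (\<Sum>k\<le>n. - of_nat (n choose k) * ?e (Suc k))"
    unfolding sum.atMost_Suc_shift by (simp add: algebra_simps)
  also have "\<dots> = (\<Sum>k\<le>n. z / of_nat (Suc n) * (of_nat (Suc n choose Suc k) * ?e k))"
  proof (intro sum.cong refl)
    fix k
    \<comment> \<open>This absorption identity is the source of the factor 1 / (n + 1).\<close>
    have "of_nat (Suc n) * of_nat (n choose k) = (of_nat (Suc n choose Suc k) * of_nat (Suc k) :: 'a)"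
      by (metis Suc_times_binomial_eq of_nat_mult)
    then have "of_nat (n choose k) = (of_nat (Suc n choose Suc k) * of_nat (Suc k) / of_nat (Suc n) :: 'a)"
      by (simp add: nonzero_eq_divide_eq mult.commute del: of_nat_Suc binomial_Suc_Suc)
    moreover have "?e (Suc k) = - z * ?e k / of_nat (Suc k)"
      by (simp add: fact_Suc del: of_nat_Suc)
    ultimately show "- of_nat (n choose k) * ?e (Suc k)
        = z / of_nat (Suc n) * (of_nat (Suc n choose Suc k) * ?e k)"
      by (simp del: of_nat_Suc binomial_Suc_Suc power_Suc fact_Suc)
  qed
  also have "\<dots> = z * laguerre1_seq z (Suc n) / of_nat (Suc n)"
    by (subst laguerre1_seq_eq[OF order_refl]) (simp only: sum_distrib_left sum_divide_distrib times_divide_eq_left)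
  finally show ?thesis .
qed

theorem corollary1p3:
  fixes m :: nat
  assumes "m \<ge> 2"
  shows "{z :: complex. poly (laguerre1 m) z = 0}
    \<subseteq> complex_of_real ` {2 - 2 * cos (pi / (real m + 1)) .. (2 - 2 * cos (real m * pi / (real m + 1))) * real m}"
proof
  fix z :: complex
  assume "z \<in> {z. poly (laguerre1 m) z = 0}"
  define w where "w = laguerre1_seq z"
  have w0: "w 0 = 0" and w1: "w (Suc 0) = 1" and wm: "w (Suc m) = 0"
    using \<open>z \<in> _\<close> by (simp_all add: w_def laguerre1_seq_def poly_laguerre1)
  define c where "c = 2 * cos (pi / (real m + 1))"
  define S where "S = (\<Sum>k\<le>m. (cmod (w k))\<^sup>2)"
  define E where "E = (\<Sum>k\<le>m. (cmod (w (Suc k) - w k))\<^sup>2)"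
  define D where "D = (\<Sum>k<m. (cmod (w (Suc k)))\<^sup>2 / real (Suc k))"
  have E: "(2 - c) * S \<le> E" "E \<le> (2 + c) * S"
    using dirichlet_energy_bounds[of w m] w0 wm by (simp_all add: c_def S_def E_def)
  have S: "S = (\<Sum>k<m. (cmod (w (Suc k)))\<^sup>2)"
    by (simp add: S_def w0 sum.lessThan_Suc_shift flip: lessThan_Suc_atMost del: sum.lessThan_Suc)
  \<comment> \<open>The first entry is L_0 = 1, so \<open>w\<close> is not the zero vector and
    \<open>D\<close> may be divided by.\<close>
  have "(cmod (w (Suc 0)))\<^sup>2 / real (Suc 0) \<le> D"
    unfolding D_def using assms by (intro member_le_sum) auto
  then have "D > 0"
    using w1 by simp
  have "D \<le> S"
    unfolding D_def S by (intro sum_mono) (simp add: divide_le_eq distrib_left)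
  have "S \<le> real m * D"
    unfolding D_def S sum_distrib_left
  proof (intro sum_mono)
    fix k assume "k \<in> {..<m}"
    then have "(cmod (w (Suc k)))\<^sup>2 * real (Suc k) \<le> (cmod (w (Suc k)))\<^sup>2 * real m"
      by (intro mult_left_mono) auto
    then show "(cmod (w (Suc k)))\<^sup>2 \<le> real m * ((cmod (w (Suc k)))\<^sup>2 / real (Suc k))"
      by (simp add: le_divide_eq mult.commute del: of_nat_Suc)
  qed
  \<comment> \<open>Pairing the recurrence with the conjugate of \<open>w\<close> turns it into an
    equation between real forms, so \<open>z\<close> is real.\<close>
  have "z * of_real D = (\<Sum>k<m. cnj (w (Suc k)) * (2 * w (Suc k) - w (Suc (Suc k)) - w k))"
    unfolding w_def laguerre1_seq_rec D_def of_real_sum of_real_divide complex_norm_square sum_distrib_left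
    by (intro sum.cong refl) (simp add: mult.commute mult.left_commute del: of_nat_Suc)
  also have "\<dots> = of_real E"
    by (simp add: second_difference_summation_by_parts E_def w0 wm)
  finally have z: "z = of_real (E / D)"
    using \<open>D > 0\<close> by (simp add: field_simps)
  have "real m * pi / (real m + 1) = pi - pi / (real m + 1)"
    by (simp add: field_simps)
  then have c': "2 * cos (real m * pi / (real m + 1)) = - c"
    by (simp only: cos_pi_minus c_def)
  \<comment> \<open>Both 2 - c and 2 + c must be nonnegative to carry D \<le> S \<le> m D over to
    the energy bounds.\<close>
  have "\<bar>c\<bar> \<le> 2"
    using abs_cos_le_one[of "pi / (real m + 1)"] by (simp add: c_def abs_mult)
  then have "(2 - c) * D \<le> (2 - c) * S" "(2 + c) * S \<le> (2 + c) * (real m * D)"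
    using \<open>D \<le> S\<close> \<open>S \<le> real m * D\<close> by (auto intro!: mult_left_mono)
  then have "2 - c \<le> E / D" "E / D \<le> (2 + c) * real m"
    using E \<open>D > 0\<close> by (simp_all add: le_divide_eq divide_le_eq mult.assoc)
  then show "z \<in> complex_of_real ` {2 - 2 * cos (pi / (real m + 1)) .. (2 - 2 * cos (real m * pi / (real m + 1))) * real m}"
    unfolding z c' by (intro imageI) (simp add: c_def)
qed

end
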